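(* The assignments $H\mapsto H^{\dagger}$ and $f\mapsto f^{\dagger}$ define a functor $(\ )^{\dagger}:\mathsf{Hil}\to\mathsf{gH}$.
   Context: A Hilbert algebra is an algebra $(H,\to,1)$ of type $(2,0)$ such that for all $a,b,c\in H$: $a\to(b\to a)=1$; $(a\to(b\to c))\to((a\to b)\to(a\to c))=1$; and $a\to b=b\to a=1$ implies $a=b$. $\mathsf{Hil}$ is the category of Hilbert algebras and homomorphisms. A generalized Heyting algebra ($gH$-algebra) is a lattice $H$ such that for all $a,b\in H$ the maximum of $\{c\in H:a\wedge c\le b\}$ exists, denoted $a\to b$; it has a greatest element $1$ and is regarded as an algebra $(H,\wedge,\vee,\to,1)$. $\mathsf{gH}$ is the category of $gH$-algebras and homomorphisms. An implicative filter of a Hilbert algebra $H$ is a subset $F\subseteq H$ with $1\in F$ and such that $a\in F$, $a\to b\in F$ imply $b\in F$; $\mathsf{Fil}(H)$ is the set of these. $F\in\mathsf{Fil}(H)$ is irreducible if it is proper and, for all $F_1,F_2\in\mathsf{Fil}(H)$, $F=F_1\cap F_2$ implies $F=F_1$ or $F=F_2$. $X(H)$ is the set of irreducible implicative filters. $X^{\vee}(H)=\{F\in\mathsf{Fil}(H):F=\bigcap X_0\text{ for some finite nonempty }X_0\subseteq X(H)\}$, ordered by inclusion. $(X^{\vee}(H))^+$ is the set of upsets of $X^{\vee}(H)$, a complete Heyting algebra under $\cap,\cup$ and $U\Rightarrow V=(U\cap V^c]^c$, where $(Y]$ is the downset generated by $Y$ and $Y^c$ the complement in $X^{\vee}(H)$.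 Define $\Phi:H\to(X^{\vee}(H))^+$ by $\Phi(a)=\{F\in X^{\vee}(H):a\in F\}$, and let $H^{\dagger}$ be the $gH$-subalgebra of $(X^{\vee}(H))^+$ generated by $\Phi(H)$. For a homomorphism $f:H\to G$ of Hilbert algebras, $R_f^{\vee}\subseteq X^{\vee}(G)\times X^{\vee}(H)$ is defined by $(I,J)\in R_f^{\vee}$ iff $f^{-1}(I)\subseteq J$, and $R_f^{\vee}(I)=\{J:(I,J)\in R_f^{\vee}\}$. The map $f^{\dagger}:H^{\dagger}\to G^{\dagger}$ is $f^{\dagger}(U)=\{F\in X^{\vee}(G):R_f^{\vee}(F)\subseteq U\}$. *)

theory Defs
  imports "HOL-Algebra.Lattice" "HOL-Library.FuncSet"
begin

record 'a hilbert = "'a partial_object" +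
  himp :: "'a \<Rightarrow> 'a \<Rightarrow> 'a"
  hone :: 'a

locale hilbert_algebra =
  fixes H :: "'a hilbert"
  assumes himp_closed: "\<lbrakk>a \<in> carrier H; b \<in> carrier H\<rbrakk> \<Longrightarrow> himp H a b \<in> carrier H"
    and hone_closed: "hone H \<in> carrier H"
    and himp_K: "\<lbrakk>a \<in> carrier H; b \<in> carrier H\<rbrakk>
      \<Longrightarrow> himp H a (himp H b a) = hone H"
    and himp_S: "\<lbrakk>a \<in> carrier H; b \<in> carrier H; c \<in> carrier H\<rbrakk>
      \<Longrightarrow> himp H (himp H a (himp H b c)) (himp H (himp H a b) (himp H a c)) = hone H"
    and himp_antisym: "\<lbrakk>a \<in> carrier H; b \<in> carrier H; himp H a b = hone H; himp H b a = hone H\<rbrakk>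
      \<Longrightarrow> a = b"

text \<open>Maps between carriers are taken extensional, so that equality of homomorphisms is
  equality on the carrier.\<close>

definition hilbert_hom :: "'a hilbert \<Rightarrow> 'b hilbert \<Rightarrow> ('a \<Rightarrow> 'b) set" where
  "hilbert_hom H G =
    {f \<in> carrier H \<rightarrow>\<^sub>E carrier G.
       f (hone H) = hone G \<and>
       (\<forall>a\<in>carrier H. \<forall>b\<in>carrier H. f (himp H a b) = himp G (f a) (f b))}"

record 'a gheyting = "'a partial_object" +
  gmeet :: "'a \<Rightarrow> 'a \<Rightarrow> 'a"
  gjoin :: "'a \<Rightarrow> 'a \<Rightarrow> 'a"
  gimp :: "'a \<Rightarrow> 'a \<Rightarrow> 'a"
  gone :: 'a

definition gH_order :: "'a gheyting \<Rightarrow> 'a gorder" where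
  "gH_order A = \<lparr>carrier = carrier A, eq = (=), le = (\<lambda>a b. gmeet A a b = a)\<rparr>"

locale gH_algebra =
  fixes A :: "'a gheyting"
  assumes lattice: "lattice (gH_order A)"
    and gmeet: "\<lbrakk>a \<in> carrier A; b \<in> carrier A\<rbrakk> \<Longrightarrow> gmeet A a b = a \<sqinter>\<^bsub>gH_order A\<^esub> b"
    and gjoin: "\<lbrakk>a \<in> carrier A; b \<in> carrier A\<rbrakk> \<Longrightarrow> gjoin A a b = a \<squnion>\<^bsub>gH_order A\<^esub> b"
    and gimp: "\<lbrakk>a \<in> carrier A; b \<in> carrier A\<rbrakk> \<Longrightarrow>
      greatest (gH_order A) (gimp A a b) {c \<in> carrier A. gmeet A a c \<sqsubseteq>\<^bsub>gH_order A\<^esub> b}"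
    and gone: "greatest (gH_order A) (gone A) (carrier A)"

definition gH_hom :: "'a gheyting \<Rightarrow> 'b gheyting \<Rightarrow> ('a \<Rightarrow> 'b) set" where
  "gH_hom A B =
    {f \<in> carrier A \<rightarrow>\<^sub>E carrier B.
       f (gone A) = gone B \<and>
       (\<forall>a\<in>carrier A. \<forall>b\<in>carrier A.
          f (gmeet A a b) = gmeet B (f a) (f b) \<and>
          f (gjoin A a b) = gjoin B (f a) (f b) \<and>
          f (gimp A a b) = gimp B (f a) (f b))}"

definition gH_subuniverse :: "'a gheyting \<Rightarrow> 'a set \<Rightarrow> bool" where
  "gH_subuniverse A S \<longleftrightarrow>
     S \<subseteq> carrier A \<and> gone A \<in> S \<and>
     (\<forall>a\<in>S. \<forall>b\<in>S. gmeet A a b \<in> S \<and> gjoin A a b \<in> S \<and> gimp A a b \<in> S)"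

definition gH_generated :: "'a gheyting \<Rightarrow> 'a set \<Rightarrow> 'a gheyting" where
  "gH_generated A Y = A\<lparr>carrier := \<Inter>{S. gH_subuniverse A S \<and> Y \<subseteq> S}\<rparr>"

definition downset :: "'b set set \<Rightarrow> 'b set set \<Rightarrow> 'b set set" where
  "downset P Y = {F \<in> P. \<exists>G\<in>Y. F \<subseteq> G}"

definition upsets :: "'b set set \<Rightarrow> 'b set set set" where
  "upsets P = {U. U \<subseteq> P \<and> (\<forall>F\<in>U. \<forall>G\<in>P. F \<subseteq> G \<longrightarrow> G \<in> U)}"

definition upset_algebra :: "'b set set \<Rightarrow> 'b set set gheyting" where
  "upset_algebra P =
    \<lparr>carrier = upsets P, gmeet = (\<inter>), gjoin = (\<union>),
     gimp = (\<lambda>U V. P - downset P (U \<inter> (P - V))), gone = P\<rparr>"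

definition Fil :: "'a hilbert \<Rightarrow> 'a set set" where
  "Fil H = {F. F \<subseteq> carrier H \<and> hone H \<in> F \<and>
     (\<forall>a\<in>carrier H. \<forall>b\<in>carrier H. a \<in> F \<longrightarrow> himp H a b \<in> F \<longrightarrow> b \<in> F)}"

definition irr_filters :: "'a hilbert \<Rightarrow> 'a set set" where
  "irr_filters H = {F \<in> Fil H. F \<noteq> carrier H \<and>
     (\<forall>F\<^sub>1\<in>Fil H. \<forall>F\<^sub>2\<in>Fil H. F = F\<^sub>1 \<inter> F\<^sub>2 \<longrightarrow> F = F\<^sub>1 \<or> F = F\<^sub>2)}"

definition XV :: "'a hilbert \<Rightarrow> 'a set set" where
  "XV H = {F \<in> Fil H. \<exists>X\<^sub>0. finite X\<^sub>0 \<and> X\<^sub>0 \<noteq> {} \<and> X\<^sub>0 \<subseteq> irr_filters H \<and> F = \<Inter>X\<^sub>0}"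

definition Phi :: "'a hilbert \<Rightarrow> 'a \<Rightarrow> 'a set set" where
  "Phi H a = {F \<in> XV H. a \<in> F}"

definition dagger :: "'a hilbert \<Rightarrow> 'a set set gheyting" where
  "dagger H = gH_generated (upset_algebra (XV H)) (Phi H ` carrier H)"

definition RV :: "'a hilbert \<Rightarrow> 'b hilbert \<Rightarrow> ('a \<Rightarrow> 'b) \<Rightarrow> ('b set \<times> 'a set) set" where
  "RV H G f = {(I, J). I \<in> XV G \<and> J \<in> XV H \<and> {a \<in> carrier H. f a \<in> I} \<subseteq> J}"

definition dagger_map ::
    "'a hilbert \<Rightarrow> 'b hilbert \<Rightarrow> ('a \<Rightarrow> 'b) \<Rightarrow> 'a set set \<Rightarrow> 'b set set" where
  "dagger_map H G f = (\<lambda>U\<in>carrier (dagger H). {F \<in> XV G. RV H G f `` {F} \<subseteq> U})"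

text \<open>Hom-sets are indexed by their source and target and need not be disjoint.
  \<^term>\<open>cmp C x y z g f\<close> is the composite of \<open>f : x \<rightarrow> y\<close> and \<open>g : y \<rightarrow> z\<close>.\<close>

record ('o, 'm) cat =
  ob :: "'o set"
  mor :: "'o \<Rightarrow> 'o \<Rightarrow> 'm set"
  idn :: "'o \<Rightarrow> 'm"
  cmp :: "'o \<Rightarrow> 'o \<Rightarrow> 'o \<Rightarrow> 'm \<Rightarrow> 'm \<Rightarrow> 'm"

locale is_category =
  fixes C :: "('o, 'm) cat"
  assumes idn_mor: "x \<in> ob C \<Longrightarrow> idn C x \<in> mor C x x"
    and cmp_mor: "\<lbrakk>x \<in> ob C; y \<in> ob C; z \<in> ob C; f \<in> mor C x y; g \<in> mor C y z\<rbrakk>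
      \<Longrightarrow> cmp C x y z g f \<in> mor C x z"
    and cmp_idn: "\<lbrakk>x \<in> ob C; y \<in> ob C; f \<in> mor C x y\<rbrakk> \<Longrightarrow> cmp C x x y f (idn C x) = f"
    and idn_cmp: "\<lbrakk>x \<in> ob C; y \<in> ob C; f \<in> mor C x y\<rbrakk> \<Longrightarrow> cmp C x y y (idn C y) f = f"
    and cmp_assoc: "\<lbrakk>w \<in> ob C; x \<in> ob C; y \<in> ob C; z \<in> ob C;
        f \<in> mor C w x; g \<in> mor C x y; h \<in> mor C y z\<rbrakk>
      \<Longrightarrow> cmp C w y z h (cmp C w x y g f) = cmp C w x z (cmp C x y z h g) f"

locale is_functor = C: is_category C + D: is_category D
  for C :: "('o, 'm) cat" and D :: "('p, 'n) cat" +
  fixes F_ob :: "'o \<Rightarrow> 'p" and F_mor :: "'o \<Rightarrow> 'o \<Rightarrow> 'm \<Rightarrow> 'n"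
  assumes F_ob: "x \<in> ob C \<Longrightarrow> F_ob x \<in> ob D"
    and F_mor: "\<lbrakk>x \<in> ob C; y \<in> ob C; f \<in> mor C x y\<rbrakk> \<Longrightarrow> F_mor x y f \<in> mor D (F_ob x) (F_ob y)"
    and F_idn: "x \<in> ob C \<Longrightarrow> F_mor x x (idn C x) = idn D (F_ob x)"
    and F_cmp: "\<lbrakk>x \<in> ob C; y \<in> ob C; z \<in> ob C; f \<in> mor C x y; g \<in> mor C y z\<rbrakk>
      \<Longrightarrow> F_mor x z (cmp C x y z g f)
          = cmp D (F_ob x) (F_ob y) (F_ob z) (F_mor y z g) (F_mor x y f)"

text \<open>The algebras whose carriers are subsets of an arbitrary type \<open>'a\<close>, which acts as universe.\<close>

definition Hil :: "('a hilbert, 'a \<Rightarrow> 'a) cat" where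
  "Hil = \<lparr>ob = {H. hilbert_algebra H}, mor = hilbert_hom,
          idn = (\<lambda>H. \<lambda>a\<in>carrier H. a), cmp = (\<lambda>H G K g f. compose (carrier H) g f)\<rparr>"

definition gH :: "('a gheyting, 'a \<Rightarrow> 'a) cat" where
  "gH = \<lparr>ob = {A. gH_algebra A}, mor = gH_hom,
         idn = (\<lambda>A. \<lambda>a\<in>carrier A. a), cmp = (\<lambda>A B C g f. compose (carrier A) g f)\<rparr>"

end

theory Submission
  imports Defs
begin

text \<open>Write \<open>pre F\<close> for the inverse image of a filter \<open>F\<close> of \<open>G\<close> under \<open>f : H \<rightarrow> G\<close>. On upsets of
  \<open>XV H\<close>, the map \<open>dagger_map H G f\<close> is the box operator of the relation \<open>pre F \<subseteq> J\<close> between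
  \<open>XV G\<close> and \<open>XV H\<close>. A box operator preserves the top element and intersections. That this one
  is a homomorphism for the other two operations comes from two properties of the relation.

  Joins are preserved because \<open>XV H\<close> is closed under binary intersection: if
  \<open>J\<^sub>1 \<notin> U\<close> and \<open>J\<^sub>2 \<notin> V\<close> are related to \<open>F\<close>, then \<open>J\<^sub>1 \<inter> J\<^sub>2\<close> is still related to \<open>F\<close>, and
  it lies outside both upsets (\<open>box_Un\<close>). This is what finite
  intersections of irreducible filters achieve and irreducible filters alone do not.

  Implications are preserved because the relation lifts (\<open>XV_lifts\<close>): if \<open>pre F \<subseteq> J\<close>, some
  \<open>F' \<supseteq> F\<close> in \<open>XV G\<close> has \<open>pre F' = J\<close> exactly, so that the filters related to \<open>F'\<close> are those
  above \<open>J\<close>. For irreducible \<open>J\<close> such an \<open>F'\<close> is found by Zorn's lemma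
  (\<open>irr_filter_lifts\<close>), and the general case follows by intersecting finitely many lifts.

  The separation of a point from a filter by an irreducible filter gives
  \<open>box (Phi H a) = Phi G (f a)\<close> (\<open>box_Phi\<close>). Everything else is formal: the box operator carries the
  generators of \<open>dagger H\<close> into \<open>dagger G\<close>, hence it carries the generated subalgebra there, and
  functoriality holds since homomorphisms out of \<open>dagger H\<close> are determined by their
  values on the generators \<open>Phi H a\<close>.\<close>

section \<open>Implicative filters\<close>

context hilbert_algebra
begin

text \<open>Antisymmetry applied to \<open>a \<rightarrow> 1\<close> and \<open>1\<close>. The axiom \<open>himp_K\<close> gives \<open>1 \<rightarrow> (a \<rightarrow> 1) = 1\<close>, and
  replacing the last \<open>1\<close> of \<open>(a \<rightarrow> 1) \<rightarrow> 1\<close> by this expression makes it an instance of the same axiom.\<close>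

lemma himp_one_right: "a \<in> carrier H \<Longrightarrow> himp H a (hone H) = hone H"
  by (metis himp_closed hone_closed himp_K himp_antisym)

lemma himp_refl:
  assumes a: "a \<in> carrier H" shows "himp H a a = hone H"
proof -
  have detach: "x = hone H" if "x \<in> carrier H" "himp H (hone H) x = hone H" for x
    using that himp_one_right himp_antisym hone_closed by blast
  \<comment> \<open>The combinatory identity \<open>S K K = I\<close>.\<close>
  have "himp H (himp H a (himp H a a)) (himp H a a) = hone H"
    using himp_S[OF a himp_closed[OF a a] a] himp_K[OF a himp_closed[OF a a]]
      himp_K[OF a a] a himp_closed hone_closed detach by metis
  then show ?thesis using himp_K[OF a a] detach himp_closed a by metis
qed

lemma FilD:
  assumes "F \<in> Fil H"
  shows "F \<subseteq> carrier H" "hone H \<in> F"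
    "\<lbrakk>a \<in> F; himp H a b \<in> F; b \<in> carrier H\<rbrakk> \<Longrightarrow> b \<in> F"
  using assms unfolding Fil_def by blast+

lemma Fil_Inter:
  assumes "X \<noteq> {}" "X \<subseteq> Fil H" shows "\<Inter>X \<in> Fil H"
proof -
  have X: "\<And>F. F \<in> X \<Longrightarrow> F \<in> Fil H" using assms(2) by auto
  have "\<Inter>X \<subseteq> carrier H" using assms(1) FilD(1)[OF X] by blast
  moreover have "b \<in> \<Inter>X" if "a \<in> \<Inter>X" "himp H a b \<in> \<Inter>X" "b \<in> carrier H" for a b
    using that FilD(3)[OF X] by blast
  moreover have "hone H \<in> \<Inter>X" using FilD(2)[OF X] by blast
  ultimately show ?thesis unfolding Fil_def by blast
qed

text \<open>The filter generated by \<open>F\<close> and one further element \<open>c\<close>, in a form that avoids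
  iterated implications: that \<open>{x. c \<rightarrow> x \<in> F}\<close> is a filter is the axiom \<open>himp_S\<close>.\<close>

lemma Fil_residual:
  assumes F: "F \<in> Fil H" and c: "c \<in> carrier H"
  defines "F' \<equiv> {x \<in> carrier H. himp H c x \<in> F}"
  shows "F' \<in> Fil H" "F \<subseteq> F'" "c \<in> F'"
proof -
  have mp: "y \<in> F'" if "x \<in> F'" "himp H x y \<in> F'" and y: "y \<in> carrier H" for x y
  proof -
    have x: "x \<in> carrier H" "himp H c x \<in> F" "himp H c (himp H x y) \<in> F"
      using that by (auto simp: F'_def)
    have "himp H (himp H c (himp H x y)) (himp H (himp H c x) (himp H c y)) \<in> F"
      using himp_S[OF c x(1) y] FilD(2)[OF F] by simp
    then have "himp H (himp H c x) (himp H c y) \<in> F"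
      using FilD(3)[OF F x(3)] c x(1) y himp_closed by simp
    then show ?thesis using FilD(3)[OF F x(2)] c y himp_closed by (simp add: F'_def)
  qed
  have one: "hone H \<in> F'"
    using himp_one_right[OF c] FilD(2)[OF F] hone_closed by (simp add: F'_def)
  show "F' \<in> Fil H"
    using mp one F'_def unfolding Fil_def by blast
  show "F \<subseteq> F'"
  proof
    fix x assume x: "x \<in> F"
    then have xc: "x \<in> carrier H" using FilD(1)[OF F] by auto
    have "himp H x (himp H c x) \<in> F" using himp_K[OF xc c] FilD(2)[OF F] by simp
    then show "x \<in> F'" using FilD(3)[OF F x] xc c himp_closed by (simp add: F'_def)
  qed
  show "c \<in> F'" using himp_refl[OF c] FilD(2)[OF F] c by (simp add: F'_def)
qed

text \<open>Both constructions of irreducible filters start here, with different avoided sets \<open>S\<close>: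
  a single point when separating, the image of a complement when lifting.\<close>

lemma Fil_maximal_avoiding:
  assumes F: "F \<in> Fil H" and FS: "F \<inter> S = {}"
  obtains Q where "Q \<in> Fil H" "F \<subseteq> Q" "Q \<inter> S = {}"
    "\<And>Q'. \<lbrakk>Q' \<in> Fil H; Q \<subseteq> Q'; Q' \<inter> S = {}\<rbrakk> \<Longrightarrow> Q' = Q"
proof -
  define \<A> where "\<A> = {Q \<in> Fil H. F \<subseteq> Q \<and> Q \<inter> S = {}}"
  have "\<exists>M\<in>\<A>. \<forall>X\<in>\<A>. M \<subseteq> X \<longrightarrow> X = M"
  proof (rule subset_Zorn_nonempty)
    show "\<A> \<noteq> {}" using F FS by (auto simp: \<A>_def)
    fix C assume ne: "C \<noteq> {}" and ch: "subset.chain \<A> C"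
    have sub: "C \<subseteq> Fil H" "\<And>Q. Q \<in> C \<Longrightarrow> F \<subseteq> Q \<and> Q \<inter> S = {}"
      using ch by (auto simp: \<A>_def subset.chain_def)
    have "b \<in> \<Union>C" if ab: "a \<in> \<Union>C" "himp H a b \<in> \<Union>C" "b \<in> carrier H" for a b
    proof -
      obtain Q1 Q2 where Q: "Q1 \<in> C" "a \<in> Q1" "Q2 \<in> C" "himp H a b \<in> Q2" using ab by auto
      have "Q1 \<subseteq> Q2 \<or> Q2 \<subseteq> Q1" using subset.chain_total[OF ch] Q by blast
      then obtain Q where "Q \<in> C" "a \<in> Q" "himp H a b \<in> Q" using Q by blast
      then show ?thesis using FilD(3)[of Q a b] sub(1) ab(3) by auto
    qed
    moreover have "\<Union>C \<subseteq> carrier H" "hone H \<in> \<Union>C" using sub(1) FilD(1,2) ne by blast+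
    ultimately have "\<Union>C \<in> Fil H" unfolding Fil_def by blast
    then show "\<Union>C \<in> \<A>" using sub(2) ne unfolding \<A>_def by blast
  qed
  then obtain Q where Q: "Q \<in> \<A>" and max: "\<forall>X\<in>\<A>. Q \<subseteq> X \<longrightarrow> X = Q" by blast
  show ?thesis
  proof (rule that)
    show "Q \<in> Fil H" "F \<subseteq> Q" "Q \<inter> S = {}" using Q by (auto simp: \<A>_def)
    show "Q' = Q" if "Q' \<in> Fil H" "Q \<subseteq> Q'" "Q' \<inter> S = {}" for Q'
      using max that \<open>F \<subseteq> Q\<close> by (auto simp: \<A>_def)
  qed
qed

lemma irr_filter_separates:
  assumes F: "F \<in> Fil H" and a: "a \<in> carrier H" "a \<notin> F"
  obtains P where "P \<in> irr_filters H" "F \<subseteq> P" "a \<notin> P"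
proof -
  obtain Q where Q: "Q \<in> Fil H" "F \<subseteq> Q" "Q \<inter> {a} = {}"
    and max: "\<And>Q'. \<lbrakk>Q' \<in> Fil H; Q \<subseteq> Q'; Q' \<inter> {a} = {}\<rbrakk> \<Longrightarrow> Q' = Q"
    using Fil_maximal_avoiding[OF F, of "{a}"] a(2) by blast
  \<comment> \<open>Filters strictly above \<open>Q\<close> contain \<open>a\<close>, so no two of them intersect in \<open>Q\<close>.\<close>
  have "Q \<in> irr_filters H"
    unfolding irr_filters_def using Q max a(1) by blast
  then show ?thesis using that Q by blast
qed

lemma XV_alt: "F \<in> XV H \<longleftrightarrow> (\<exists>X. finite X \<and> X \<noteq> {} \<and> X \<subseteq> irr_filters H \<and> F = \<Inter>X)"
proof -
  have "irr_filters H \<subseteq> Fil H" by (auto simp: irr_filters_def)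
  then show ?thesis unfolding XV_def using Fil_Inter by blast
qed

lemma irr_filters_subset_XV: "irr_filters H \<subseteq> XV H"
proof
  fix P assume "P \<in> irr_filters H"
  then show "P \<in> XV H" unfolding XV_alt by (intro exI[of _ "{P}"]) auto
qed

lemma XV_Int:
  assumes "F \<in> XV H" "F' \<in> XV H" shows "F \<inter> F' \<in> XV H"
proof -
  obtain X X' where "finite X" "X \<noteq> {}" "X \<subseteq> irr_filters H" "F = \<Inter>X"
    "finite X'" "X' \<noteq> {}" "X' \<subseteq> irr_filters H" "F' = \<Inter>X'"
    using assms unfolding XV_alt by blast
  then show ?thesis unfolding XV_alt by (intro exI[of _ "X \<union> X'"]) auto
qed

lemma XV_subset_Fil: "XV H \<subseteq> Fil H"
  by (auto simp: XV_def)

lemma Phi_upset: "Phi H a \<in> upsets (XV H)"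
  by (auto simp: Phi_def upsets_def)

end

section \<open>Generalized Heyting algebras of upsets\<close>

lemma gH_subuniverse_generated:
  assumes "gH_subuniverse A (carrier A)" "Y \<subseteq> carrier A"
  shows "gH_subuniverse A (carrier (gH_generated A Y))"
proof -
  let ?C = "\<Inter>{S. gH_subuniverse A S \<and> Y \<subseteq> S}"
  have "?C \<subseteq> carrier A" using assms by blast
  then have "gH_subuniverse A ?C" unfolding gH_subuniverse_def by blast
  then show ?thesis by (simp add: gH_generated_def)
qed

lemma gH_generated_minimal:
  "\<lbrakk>gH_subuniverse A S; Y \<subseteq> S\<rbrakk> \<Longrightarrow> carrier (gH_generated A Y) \<subseteq> S"
  unfolding gH_generated_def by auto

lemma gH_generated_contains: "Y \<subseteq> carrier (gH_generated A Y)"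
  unfolding gH_generated_def by auto

lemma gH_generated_sel:
  "gmeet (gH_generated A Y) = gmeet A" "gjoin (gH_generated A Y) = gjoin A"
  "gimp (gH_generated A Y) = gimp A" "gone (gH_generated A Y) = gone A"
  by (simp_all add: gH_generated_def)

lemma upset_algebra_closed: "gH_subuniverse (upset_algebra P) (carrier (upset_algebra P))"
proof -
  have "P - downset P (U \<inter> (P - V)) \<in> upsets P" for U V
    unfolding upsets_def downset_def by blast
  moreover have "U \<inter> V \<in> upsets P" "U \<union> V \<in> upsets P" if "U \<in> upsets P" "V \<in> upsets P" for U V
    using that unfolding upsets_def by blast+
  moreover have "P \<in> upsets P" unfolding upsets_def by blast
  ultimately show ?thesis unfolding gH_subuniverse_def upset_algebra_def by simp
qed

text \<open>In a subalgebra \<open>S\<close> the order, suprema and infima are set-theoretic because \<open>S\<close> contains the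
  unions and intersections of its members. The residual of \<open>U\<close> and \<open>V\<close> is the largest among all
  upsets \<open>W\<close> with \<open>U \<inter> W \<subseteq> V\<close>, hence the largest in \<open>S\<close>.\<close>

lemma upset_subalgebra_is_gH:
  assumes S: "gH_subuniverse (upset_algebra P) S"
  shows "gH_algebra (upset_algebra P\<lparr>carrier := S\<rparr>)"
proof -
  let ?A = "upset_algebra P\<lparr>carrier := S\<rparr>"
  let ?L = "gH_order ?A"
  have L: "carrier ?L = S" "\<And>x y. x \<sqsubseteq>\<^bsub>?L\<^esub> y \<longleftrightarrow> x \<subseteq> y" "\<And>x y. x .=\<^bsub>?L\<^esub> y \<longleftrightarrow> x = y"
    by (auto simp: gH_order_def upset_algebra_def)
  have S': "S \<subseteq> upsets P" "P \<in> S" "\<And>U V. \<lbrakk>U \<in> S; V \<in> S\<rbrakk> \<Longrightarrow> U \<inter> V \<in> S"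
    "\<And>U V. \<lbrakk>U \<in> S; V \<in> S\<rbrakk> \<Longrightarrow> U \<union> V \<in> S"
    "\<And>U V. \<lbrakk>U \<in> S; V \<in> S\<rbrakk> \<Longrightarrow> P - downset P (U \<inter> (P - V)) \<in> S"
    using S by (auto simp: gH_subuniverse_def upset_algebra_def)
  interpret partial_order ?L
    by unfold_locales (auto simp: L fun_eq_iff)
  have sup: "least ?L (U \<union> V) (Upper ?L {U, V})" and inf: "greatest ?L (U \<inter> V) (Lower ?L {U, V})"
    if "U \<in> S" "V \<in> S" for U V
    using that S'(3,4) by (auto simp: least_def greatest_def Upper_def Lower_def L)
  interpret lattice ?L
  proof
    show "\<exists>W. least ?L W (Upper ?L {U, V})" "\<exists>W. greatest ?L W (Lower ?L {U, V})"
      if "U \<in> carrier ?L" "V \<in> carrier ?L" for U V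
      using sup[of U V] inf[of U V] that unfolding L(1) by blast+
  qed
  have join: "U \<squnion>\<^bsub>?L\<^esub> V = U \<union> V" and meet: "U \<sqinter>\<^bsub>?L\<^esub> V = U \<inter> V" if "U \<in> S" "V \<in> S" for U V
  proof -
    show "U \<squnion>\<^bsub>?L\<^esub> V = U \<union> V"
      unfolding join_def Lattice.sup_def
    proof (rule some_equality, rule sup[OF that])
      fix W assume "least ?L W (Upper ?L {U, V})"
      then show "W = U \<union> V"
        using sup[OF that] by (rule least_unique)
    qed
    show "U \<sqinter>\<^bsub>?L\<^esub> V = U \<inter> V"
      unfolding meet_def Lattice.inf_def
    proof (rule some_equality, rule inf[OF that])
      fix W assume "greatest ?L W (Lower ?L {U, V})"
      then show "W = U \<inter> V"
        using inf[OF that] by (rule greatest_unique)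
    qed
  qed
  have imp: "greatest ?L (P - downset P (U \<inter> (P - V))) {W \<in> S. U \<inter> W \<subseteq> V}"
    if "U \<in> S" "V \<in> S" for U V
  proof -
    have "U \<inter> (P - downset P (U \<inter> (P - V))) \<subseteq> V"
      by (auto simp: downset_def)
    moreover have "W \<subseteq> P - downset P (U \<inter> (P - V))" if "W \<in> S" "U \<inter> W \<subseteq> V" for W
    proof -
      have "W \<in> upsets P" using that S'(1) by auto
      then show ?thesis using that(2) unfolding upsets_def downset_def by blast
    qed
    ultimately show ?thesis using S'(5)[OF that] by (auto simp: greatest_def L)
  qed
  have top: "greatest ?L P S"
    using S'(1,2) by (auto simp: greatest_def L upsets_def)
  show ?thesis
  proof (rule gH_algebra.intro)
    show "lattice ?L" ..
    fix U V assume UV: "U \<in> carrier ?A" "V \<in> carrier ?A"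
    then have UV': "U \<in> S" "V \<in> S" by simp_all
    have ops: "gmeet ?A U V = U \<inter> V" "gjoin ?A U V = U \<union> V"
      "gimp ?A U V = P - downset P (U \<inter> (P - V))"
      "{W \<in> carrier ?A. gmeet ?A U W \<sqsubseteq>\<^bsub>?L\<^esub> V} = {W \<in> S. U \<inter> W \<subseteq> V}"
      unfolding L(2) by (simp_all add: upset_algebra_def)
    show "gmeet ?A U V = U \<sqinter>\<^bsub>?L\<^esub> V" "gjoin ?A U V = U \<squnion>\<^bsub>?L\<^esub> V"
      using join[OF UV'] meet[OF UV'] unfolding ops by simp_all
    show "greatest ?L (gimp ?A U V) {W \<in> carrier ?A. gmeet ?A U W \<sqsubseteq>\<^bsub>?L\<^esub> V}"
      unfolding ops by (rule imp[OF UV'])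
  next
    show "greatest ?L (gone ?A) (carrier ?A)"
      using top by (simp add: upset_algebra_def)
  qed
qed

lemma dagger_subuniverse:
  assumes "hilbert_algebra H"
  shows "gH_subuniverse (upset_algebra (XV H)) (carrier (dagger H))"
proof -
  have "Phi H ` carrier H \<subseteq> carrier (upset_algebra (XV H))"
    using hilbert_algebra.Phi_upset[OF assms] by (auto simp: upset_algebra_def)
  then show ?thesis
    unfolding dagger_def by (rule gH_subuniverse_generated[OF upset_algebra_closed])
qed

lemma dagger_sel:
  "gmeet (dagger H) = (\<inter>)" "gjoin (dagger H) = (\<union>)"
  "gimp (dagger H) = (\<lambda>U V. XV H - downset (XV H) (U \<inter> (XV H - V)))" "gone (dagger H) = XV H"
  by (simp_all add: dagger_def gH_generated_sel upset_algebra_def)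

lemma Phi_in_dagger: "a \<in> carrier H \<Longrightarrow> Phi H a \<in> carrier (dagger H)"
  unfolding dagger_def by (rule subsetD[OF gH_generated_contains]) simp

lemma dagger_subset_upsets: "hilbert_algebra H \<Longrightarrow> carrier (dagger H) \<subseteq> upsets (XV H)"
  using dagger_subuniverse[of H] by (simp add: gH_subuniverse_def upset_algebra_def)

lemma dagger_is_gH:
  assumes "hilbert_algebra H" shows "gH_algebra (dagger H)"
proof -
  have "dagger H = upset_algebra (XV H)\<lparr>carrier := carrier (dagger H)\<rparr>"
    unfolding dagger_def gH_generated_def by simp
  then show ?thesis
    using upset_subalgebra_is_gH[OF dagger_subuniverse[OF assms]] by metis
qed

section \<open>The functor on homomorphisms\<close>

locale hilbert_morphism = H: hilbert_algebra H + G: hilbert_algebra G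
  for H :: "'a hilbert" and G :: "'b hilbert" +
  fixes f :: "'a \<Rightarrow> 'b"
  assumes hom: "f \<in> hilbert_hom H G"
begin

lemma f_closed: "a \<in> carrier H \<Longrightarrow> f a \<in> carrier G"
  and f_one: "f (hone H) = hone G"
  and f_imp: "\<lbrakk>a \<in> carrier H; b \<in> carrier H\<rbrakk> \<Longrightarrow> f (himp H a b) = himp G (f a) (f b)"
  using hom by (auto simp: hilbert_hom_def)

definition pre :: "'b set \<Rightarrow> 'a set" where
  "pre F = {a \<in> carrier H. f a \<in> F}"

lemma pre_Fil: "F \<in> Fil G \<Longrightarrow> pre F \<in> Fil H"
  using f_closed f_one f_imp H.hone_closed unfolding Fil_def pre_def by auto

text \<open>Take \<open>Q \<supseteq> F\<close> maximal with \<open>pre Q \<subseteq> P\<close>. Equality holds: for \<open>p \<in> P\<close>, adjoining \<open>f p\<close> to \<open>Q\<close>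
  keeps the inverse image inside \<open>P\<close>, so \<open>f p\<close> already belongs to \<open>Q\<close>. Irreducibility passes
  from \<open>P\<close> to \<open>Q\<close> because inverse images commute with intersections: if \<open>Q = A \<inter> B\<close> then one of
  \<open>pre A\<close>, \<open>pre B\<close> is \<open>P\<close>, and maximality gives \<open>Q = A\<close> or \<open>Q = B\<close>.\<close>

lemma irr_filter_lifts:
  assumes F: "F \<in> Fil G" and P: "P \<in> irr_filters H" and FP: "pre F \<subseteq> P"
  obtains Q where "Q \<in> irr_filters G" "F \<subseteq> Q" "pre Q = P"
proof -
  have PF: "P \<in> Fil H" "P \<noteq> carrier H"
    and irr: "\<And>A B. \<lbrakk>A \<in> Fil H; B \<in> Fil H; P = A \<inter> B\<rbrakk> \<Longrightarrow> P = A \<or> P = B"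
    using P by (auto simp: irr_filters_def)
  define S where "S = f ` (carrier H - P)"
  have avoid: "Q \<inter> S = {} \<longleftrightarrow> pre Q \<subseteq> P" for Q
    by (auto simp: S_def pre_def)
  obtain Q where Q: "Q \<in> Fil G" "F \<subseteq> Q" "pre Q \<subseteq> P"
    and max: "\<And>Q'. \<lbrakk>Q' \<in> Fil G; Q \<subseteq> Q'; pre Q' \<subseteq> P\<rbrakk> \<Longrightarrow> Q' = Q"
    using G.Fil_maximal_avoiding[OF F, of S] FP unfolding avoid by blast
  have "p \<in> pre Q" if p: "p \<in> P" for p
  proof -
    have pc: "p \<in> carrier H" using p H.FilD(1)[OF PF(1)] by auto
    define Q' where "Q' = {x \<in> carrier G. himp G (f p) x \<in> Q}"
    note res = G.Fil_residual[OF Q(1) f_closed[OF pc], folded Q'_def]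
    have "b \<in> P" if "b \<in> pre Q'" for b
    proof -
      have b: "b \<in> carrier H" "himp G (f p) (f b) \<in> Q" using that by (auto simp: pre_def Q'_def)
      then have "himp H p b \<in> pre Q" using pc H.himp_closed f_imp by (simp add: pre_def)
      then show ?thesis using Q(3) H.FilD(3)[OF PF(1) p] b(1) by auto
    qed
    then have "Q' = Q" using max res(1,2) by blast
    then show ?thesis using res(3) pc by (simp add: pre_def)
  qed
  then have pQ: "pre Q = P" using Q(3) by auto
  have "Q = A \<or> Q = B" if AB: "A \<in> Fil G" "B \<in> Fil G" "Q = A \<inter> B" for A B
  proof -
    have "P = pre A \<inter> pre B" using pQ AB(3) by (auto simp: pre_def)
    then have "P = pre A \<or> P = pre B" using irr pre_Fil AB by blast
    then show ?thesis using max[of A] max[of B] AB by auto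
  qed
  moreover have "Q \<noteq> carrier G" using pQ PF(2) f_closed by (auto simp: pre_def)
  ultimately have "Q \<in> irr_filters G" using Q(1) unfolding irr_filters_def by blast
  then show ?thesis using that Q(2) pQ by blast
qed

lemma XV_lifts:
  assumes F: "F \<in> Fil G" and J: "J \<in> XV H" and FJ: "pre F \<subseteq> J"
  obtains F' where "F' \<in> XV G" "F \<subseteq> F'" "pre F' = J"
proof -
  obtain X where X: "finite X" "X \<noteq> {}" "X \<subseteq> irr_filters H" "J = \<Inter>X"
    using J unfolding H.XV_alt by blast
  have "\<exists>Q. Q \<in> irr_filters G \<and> F \<subseteq> Q \<and> pre Q = P" if "P \<in> X" for P
    using irr_filter_lifts[OF F, of P] that X FJ by blast
  then obtain q where q: "\<And>P. P \<in> X \<Longrightarrow> q P \<in> irr_filters G \<and> F \<subseteq> q P \<and> pre (q P) = P"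
    by metis
  have "\<Inter>(q ` X) \<in> XV G" unfolding G.XV_alt using X q by (intro exI[of _ "q ` X"]) auto
  moreover have "pre (\<Inter>(q ` X)) = (\<Inter>P\<in>X. pre (q P))" using X(2) by (auto simp: pre_def)
  then have "pre (\<Inter>(q ` X)) = J" using q X(4) by simp
  ultimately show ?thesis using that q by blast
qed

text \<open>The formula of \<open>dagger_map\<close> on arbitrary sets of filters. Dropping the restriction to
  the carrier of \<open>dagger H\<close> makes it possible to prove the homomorphism laws first and to deduce
  from them that the values lie in \<open>dagger G\<close>.\<close>

definition box :: "'a set set \<Rightarrow> 'b set set" where
  "box U = {F \<in> XV G. \<forall>J\<in>XV H. pre F \<subseteq> J \<longrightarrow> J \<in> U}"

lemma box_top: "box (XV H) = XV G"
  by (auto simp: box_def)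

lemma box_Int: "box (U \<inter> V) = box U \<inter> box V"
  by (auto simp: box_def)

lemma box_Un:
  assumes "U \<in> upsets (XV H)" "V \<in> upsets (XV H)"
  shows "box (U \<union> V) = box U \<union> box V"
proof
  show "box U \<union> box V \<subseteq> box (U \<union> V)" by (auto simp: box_def)
  show "box (U \<union> V) \<subseteq> box U \<union> box V"
  proof (rule ccontr)
    assume "\<not> ?thesis"
    then obtain F J1 J2 where F: "F \<in> box (U \<union> V)"
      and J: "J1 \<in> XV H" "pre F \<subseteq> J1" "J1 \<notin> U" "J2 \<in> XV H" "pre F \<subseteq> J2" "J2 \<notin> V"
      by (auto simp: box_def)
    have "J1 \<inter> J2 \<in> U \<union> V" using F J H.XV_Int by (auto simp: box_def)
    then show False using assms J unfolding upsets_def by blast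
  qed
qed

text \<open>The inclusion from left to right follows from monotonicity of \<open>pre\<close>. Conversely, to see that
  a filter \<open>J' \<in> U\<close> above \<open>pre F\<close> lies in \<open>V\<close>, lift it to \<open>F' \<supseteq> F\<close> with \<open>pre F' = J'\<close>. As \<open>U\<close> is
  an upset, \<open>F'\<close> is in \<open>box U\<close>, hence in \<open>box V\<close>, and \<open>J'\<close> itself is related to \<open>F'\<close>.\<close>

lemma box_imp:
  assumes U: "U \<in> upsets (XV H)"
  shows "box (XV H - downset (XV H) (U \<inter> (XV H - V)))
    = XV G - downset (XV G) (box U \<inter> (XV G - box V))" (is "?L = ?R")
proof
  show "?L \<subseteq> ?R"
  proof
    fix F assume F: "F \<in> ?L"
    have "F' \<in> box V" if F': "F' \<in> box U" "F \<subseteq> F'" for F'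
    proof -
      have "J \<in> V" if J: "J \<in> XV H" "pre F' \<subseteq> J" for J
      proof -
        have "J \<in> U" using J F'(1) by (auto simp: box_def)
        moreover have "pre F \<subseteq> J" using J(2) F'(2) by (auto simp: pre_def)
        then have "J \<notin> downset (XV H) (U \<inter> (XV H - V))" using F J(1) by (auto simp: box_def)
        ultimately show ?thesis using J(1) by (auto simp: downset_def)
      qed
      then show ?thesis using F'(1) by (simp add: box_def)
    qed
    then show "F \<in> ?R" using F by (auto simp: downset_def box_def[of "_ - _"])
  qed
  show "?R \<subseteq> ?L"
  proof
    fix F assume F: "F \<in> ?R"
    then have FX: "F \<in> XV G" and
      step: "\<And>F'. \<lbrakk>F' \<in> box U; F \<subseteq> F'\<rbrakk> \<Longrightarrow> F' \<in> box V"
      by (auto simp: downset_def box_def)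
    have "J' \<in> V" if J: "pre F \<subseteq> J" "J \<subseteq> J'" "J' \<in> XV H" "J' \<in> U" for J J'
    proof -
      obtain F' where F': "F' \<in> XV G" "F \<subseteq> F'" "pre F' = J'"
        using XV_lifts[of F J'] FX G.XV_subset_Fil J by blast
      have "F' \<in> box U" using F' J(4) U by (auto simp: box_def upsets_def)
      then have "F' \<in> box V" using step F'(2) by blast
      then show ?thesis using F'(3) J(3) by (simp add: box_def)
    qed
    then show "F \<in> ?L" using FX by (auto simp: box_def downset_def)
  qed
qed

lemma box_Phi:
  assumes a: "a \<in> carrier H" shows "box (Phi H a) = Phi G (f a)"
proof
  show "Phi G (f a) \<subseteq> box (Phi H a)" using a by (auto simp: Phi_def box_def pre_def)
  show "box (Phi H a) \<subseteq> Phi G (f a)"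
  proof
    fix F assume F: "F \<in> box (Phi H a)"
    have "a \<in> pre F"
    proof (rule ccontr)
      assume "a \<notin> pre F"
      moreover have "pre F \<in> Fil H" using F pre_Fil G.XV_subset_Fil by (auto simp: box_def)
      ultimately obtain P where P: "P \<in> irr_filters H" "pre F \<subseteq> P" "a \<notin> P"
        using H.irr_filter_separates a by blast
      then have "P \<in> Phi H a" using F H.irr_filters_subset_XV by (auto simp: box_def)
      then show False using P(3) by (simp add: Phi_def)
    qed
    then show "F \<in> Phi G (f a)" using F by (simp add: Phi_def box_def pre_def)
  qed
qed

text \<open>By the preceding laws, the upsets sent into \<open>dagger G\<close> form a subuniverse, and it
  contains the generators.\<close>

lemma box_dagger: "U \<in> carrier (dagger H) \<Longrightarrow> box U \<in> carrier (dagger G)"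
proof -
  have sub: "gH_subuniverse (upset_algebra (XV G)) (carrier (dagger G))"
    using dagger_subuniverse G.hilbert_algebra_axioms .
  let ?S = "{U \<in> upsets (XV H). box U \<in> carrier (dagger G)}"
  have "gH_subuniverse (upset_algebra (XV H)) ?S"
    using sub upset_algebra_closed[of "XV H"] unfolding gH_subuniverse_def
    by (auto simp: upset_algebra_def box_top box_Int box_Un box_imp)
  moreover have "Phi H ` carrier H \<subseteq> ?S"
    by (auto simp: box_Phi H.Phi_upset Phi_in_dagger f_closed)
  ultimately have "carrier (dagger H) \<subseteq> ?S"
    unfolding dagger_def[of H] by (rule gH_generated_minimal)
  then show "U \<in> carrier (dagger H) \<Longrightarrow> box U \<in> carrier (dagger G)" by auto
qed

lemma dagger_map_eq_box: "dagger_map H G f = (\<lambda>U\<in>carrier (dagger H). box U)"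
proof -
  have "{F \<in> XV G. RV H G f `` {F} \<subseteq> U} = box U" for U
    by (auto simp: RV_def box_def pre_def)
  then show ?thesis by (simp add: dagger_map_def)
qed

lemma dagger_map_Phi: "a \<in> carrier H \<Longrightarrow> dagger_map H G f (Phi H a) = Phi G (f a)"
  by (simp add: dagger_map_eq_box Phi_in_dagger box_Phi)

lemma dagger_map_hom: "dagger_map H G f \<in> gH_hom (dagger H) (dagger G)"
proof -
  have "U \<in> upsets (XV H)" if "U \<in> carrier (dagger H)" for U
    using that dagger_subset_upsets[OF H.hilbert_algebra_axioms] by auto
  moreover have "gH_subuniverse (upset_algebra (XV H)) (carrier (dagger H))"
    using dagger_subuniverse H.hilbert_algebra_axioms .
  ultimately show ?thesis
    unfolding gH_hom_def dagger_map_eq_box dagger_sel gH_subuniverse_def upset_algebra_def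
    using box_dagger by (auto simp: box_top box_Int box_Un box_imp)
qed

end

section \<open>Functoriality\<close>

lemma hilbert_hom_id: "hilbert_algebra H \<Longrightarrow> (\<lambda>a\<in>carrier H. a) \<in> hilbert_hom H H"
  by (simp add: hilbert_hom_def hilbert_algebra.himp_closed hilbert_algebra.hone_closed)

lemma hilbert_hom_compose:
  assumes H: "hilbert_algebra H" and f: "f \<in> hilbert_hom H G" and g: "g \<in> hilbert_hom G K"
  shows "compose (carrier H) g f \<in> hilbert_hom H K"
proof -
  note closed = hilbert_algebra.himp_closed[OF H] hilbert_algebra.hone_closed[OF H]
  have f': "f (hone H) = hone G" "\<And>a. a \<in> carrier H \<Longrightarrow> f a \<in> carrier G"
    "\<And>a b. \<lbrakk>a \<in> carrier H; b \<in> carrier H\<rbrakk> \<Longrightarrow> f (himp H a b) = himp G (f a) (f b)"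
    using f unfolding hilbert_hom_def by blast+
  have g': "g (hone G) = hone K" "\<And>a. a \<in> carrier G \<Longrightarrow> g a \<in> carrier K"
    "\<And>a b. \<lbrakk>a \<in> carrier G; b \<in> carrier G\<rbrakk> \<Longrightarrow> g (himp G a b) = himp K (g a) (g b)"
    using g unfolding hilbert_hom_def by blast+
  show ?thesis by (simp add: hilbert_hom_def compose_def closed f' g')
qed

lemma gH_closed:
  assumes "gH_algebra A" shows "gH_subuniverse A (carrier A)"
proof -
  interpret gH_algebra A by fact
  interpret L: lattice "gH_order A" by (rule lattice)
  have c: "carrier (gH_order A) = carrier A" by (simp add: gH_order_def)
  have "gmeet A a b \<in> carrier A" "gjoin A a b \<in> carrier A" "gimp A a b \<in> carrier A"
    if ab: "a \<in> carrier A" "b \<in> carrier A" for a b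
  proof -
    show "gmeet A a b \<in> carrier A" "gjoin A a b \<in> carrier A"
      using L.meet_closed[of a b] L.join_closed[of a b] ab
      unfolding c gmeet[OF ab] gjoin[OF ab] by blast+
    show "gimp A a b \<in> carrier A"
      using gimp[OF ab] unfolding greatest_def by blast
  qed
  moreover have "gone A \<in> carrier A" using gone unfolding greatest_def by blast
  ultimately show ?thesis by (simp add: gH_subuniverse_def)
qed

lemma gH_hom_id: "gH_algebra A \<Longrightarrow> (\<lambda>a\<in>carrier A. a) \<in> gH_hom A A"
  using gH_closed[of A] by (simp add: gH_hom_def gH_subuniverse_def)

lemma gH_hom_compose:
  assumes A: "gH_algebra A" and f: "f \<in> gH_hom A B" and g: "g \<in> gH_hom B C"
  shows "compose (carrier A) g f \<in> gH_hom A C"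
proof -
  have closed: "gone A \<in> carrier A" "\<And>a b. \<lbrakk>a \<in> carrier A; b \<in> carrier A\<rbrakk> \<Longrightarrow>
      gmeet A a b \<in> carrier A \<and> gjoin A a b \<in> carrier A \<and> gimp A a b \<in> carrier A"
    using gH_closed[OF A] unfolding gH_subuniverse_def by blast+
  have f': "f (gone A) = gone B" "\<And>a. a \<in> carrier A \<Longrightarrow> f a \<in> carrier B"
    "\<And>a b. \<lbrakk>a \<in> carrier A; b \<in> carrier A\<rbrakk> \<Longrightarrow> f (gmeet A a b) = gmeet B (f a) (f b) \<and>
      f (gjoin A a b) = gjoin B (f a) (f b) \<and> f (gimp A a b) = gimp B (f a) (f b)"
    using f unfolding gH_hom_def by blast+
  have g': "g (gone B) = gone C" "\<And>a. a \<in> carrier B \<Longrightarrow> g a \<in> carrier C"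
    "\<And>a b. \<lbrakk>a \<in> carrier B; b \<in> carrier B\<rbrakk> \<Longrightarrow> g (gmeet B a b) = gmeet C (g a) (g b) \<and>
      g (gjoin B a b) = gjoin C (g a) (g b) \<and> g (gimp B a b) = gimp C (g a) (g b)"
    using g unfolding gH_hom_def by blast+
  show ?thesis by (simp add: gH_hom_def compose_def closed f' g')
qed

lemma extensional_compose_id:
  assumes f: "f \<in> A \<rightarrow>\<^sub>E B"
  shows "compose A f (\<lambda>a\<in>A. a) = f" "compose A (\<lambda>b\<in>B. b) f = f"
  by (rule ext, use PiE_mem[OF f] PiE_arb[OF f] in \<open>simp add: compose_def restrict_def\<close>)+

lemma is_category_Hil: "is_category Hil"
proof (rule is_category.intro, goal_cases)
  case (1 x)
  then show ?case by (simp add: Hil_def hilbert_hom_id)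
next
  case (2 x y z f g)
  then show ?case by (simp add: Hil_def hilbert_hom_compose)
next
  case (3 x y f)
  then have "f \<in> carrier x \<rightarrow>\<^sub>E carrier y" by (simp add: Hil_def hilbert_hom_def)
  then show ?case by (simp add: Hil_def extensional_compose_id)
next
  case (4 x y f)
  then have "f \<in> carrier x \<rightarrow>\<^sub>E carrier y" by (simp add: Hil_def hilbert_hom_def)
  then show ?case by (simp add: Hil_def extensional_compose_id)
next
  case (5 w x y z f g h)
  then have "f \<in> carrier w \<rightarrow> carrier x" by (simp add: Hil_def hilbert_hom_def PiE_def)
  then show ?case by (simp add: Hil_def compose_assoc)
qed

lemma is_category_gH: "is_category gH"
proof (rule is_category.intro, goal_cases)
  case (1 x)
  then show ?case by (simp add: gH_def gH_hom_id)
next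
  case (2 x y z f g)
  then show ?case by (simp add: gH_def gH_hom_compose)
next
  case (3 x y f)
  then have "f \<in> carrier x \<rightarrow>\<^sub>E carrier y" by (simp add: gH_def gH_hom_def)
  then show ?case by (simp add: gH_def extensional_compose_id)
next
  case (4 x y f)
  then have "f \<in> carrier x \<rightarrow>\<^sub>E carrier y" by (simp add: gH_def gH_hom_def)
  then show ?case by (simp add: gH_def extensional_compose_id)
next
  case (5 w x y z f g h)
  then have "f \<in> carrier w \<rightarrow> carrier x" by (simp add: gH_def gH_hom_def PiE_def)
  then show ?case by (simp add: gH_def compose_assoc)
qed

text \<open>The equalizer of two homomorphisms is a subuniverse.\<close>

lemma dagger_hom_eqI:
  assumes H: "hilbert_algebra H"
    and p: "p \<in> gH_hom (dagger H) B" and q: "q \<in> gH_hom (dagger H) B"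
    and eq: "\<And>a. a \<in> carrier H \<Longrightarrow> p (Phi H a) = q (Phi H a)"
  shows "p = q"
proof -
  let ?E = "{U \<in> carrier (dagger H). p U = q U}"
  have "gH_subuniverse (upset_algebra (XV H)) ?E"
    using dagger_subuniverse[OF H] p q
    unfolding gH_subuniverse_def gH_hom_def dagger_sel by (auto simp: upset_algebra_def)
  moreover have "Phi H ` carrier H \<subseteq> ?E" using eq Phi_in_dagger by auto
  ultimately have "carrier (dagger H) \<subseteq> ?E" unfolding dagger_def[of H]
    by (rule gH_generated_minimal)
  then show ?thesis using p q unfolding gH_hom_def
    by (intro PiE_ext[of p "carrier (dagger H)" "\<lambda>_. carrier B" q]) auto
qed

lemma dagger_map_id:
  assumes H: "hilbert_algebra H"
  shows "dagger_map H H (\<lambda>a\<in>carrier H. a) = (\<lambda>U\<in>carrier (dagger H). U)"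
proof -
  interpret m: hilbert_morphism H H "\<lambda>a\<in>carrier H. a"
    using H hilbert_hom_id by (simp add: hilbert_morphism_def hilbert_morphism_axioms_def)
  show ?thesis
    by (rule dagger_hom_eqI[OF H m.dagger_map_hom gH_hom_id[OF dagger_is_gH[OF H]]])
      (simp add: m.dagger_map_Phi Phi_in_dagger)
qed

lemma dagger_map_compose:
  assumes H: "hilbert_algebra H" and G: "hilbert_algebra G" and K: "hilbert_algebra K"
    and f: "f \<in> hilbert_hom H G" and g: "g \<in> hilbert_hom G K"
  shows "dagger_map H K (compose (carrier H) g f)
    = compose (carrier (dagger H)) (dagger_map G K g) (dagger_map H G f)"
proof -
  interpret f: hilbert_morphism H G f using H G f
    by (simp add: hilbert_morphism_def hilbert_morphism_axioms_def)
  interpret g: hilbert_morphism G K g using G K g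
    by (simp add: hilbert_morphism_def hilbert_morphism_axioms_def)
  interpret gf: hilbert_morphism H K "compose (carrier H) g f"
    using H K hilbert_hom_compose[OF H f g]
    by (simp add: hilbert_morphism_def hilbert_morphism_axioms_def)
  show ?thesis
    by (rule dagger_hom_eqI[OF H gf.dagger_map_hom
          gH_hom_compose[OF dagger_is_gH[OF H] f.dagger_map_hom g.dagger_map_hom]])
      (simp add: compose_eq gf.dagger_map_Phi f.dagger_map_Phi g.dagger_map_Phi
        Phi_in_dagger f.f_closed)
qed

lemma dagger_map_is_hom:
  assumes "hilbert_algebra H" "hilbert_algebra G" "f \<in> hilbert_hom H G"
  shows "dagger_map H G f \<in> gH_hom (dagger H) (dagger G)"
proof -
  interpret hilbert_morphism H G f
    using assms by (simp add: hilbert_morphism_def hilbert_morphism_axioms_def)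
  show ?thesis by (rule dagger_map_hom)
qed

theorem proposition6:
  shows "is_functor (Hil :: ('a hilbert, 'a \<Rightarrow> 'a) cat)
           (gH :: ('a set set gheyting, 'a set set \<Rightarrow> 'a set set) cat) dagger dagger_map
    \<and> (\<forall>(H :: 'b hilbert) (G :: 'c hilbert) (K :: 'd hilbert) f g.
         hilbert_algebra H \<longrightarrow> hilbert_algebra G \<longrightarrow> hilbert_algebra K \<longrightarrow>
         f \<in> hilbert_hom H G \<longrightarrow> g \<in> hilbert_hom G K \<longrightarrow>
           dagger_map H G f \<in> gH_hom (dagger H) (dagger G) \<and>
           dagger_map H K (compose (carrier H) g f)
             = compose (carrier (dagger H)) (dagger_map G K g) (dagger_map H G f))"
proof -
  have "is_functor (Hil :: ('a hilbert, 'a \<Rightarrow> 'a) cat)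
      (gH :: ('a set set gheyting, 'a set set \<Rightarrow> 'a set set) cat) dagger dagger_map"
    by (intro is_functor.intro is_category_Hil is_category_gH is_functor_axioms.intro)
      (simp_all add: Hil_def gH_def dagger_is_gH dagger_map_is_hom dagger_map_id dagger_map_compose)
  then show ?thesis
    by (intro conjI allI impI) (assumption, erule (2) dagger_map_is_hom, erule (4) dagger_map_compose)
qed

end
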